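(* Let $V$ be a Komori variety such that $$V=V(S_{n_1},\dots,S_{n_k},S_{m_1}^\omega,\dots,S_{m_s}^\omega)=V(S_{n'_1},\dots,S_{n'_h},S_{m'_1}^\omega,\dots,S_{m'_t}^\omega).$$ Then the numbers $N=\mathrm{l.c.m.}\{n_i,m_j\mid i=1,\dots,k,\ j=1,\dots,s\}$ and $N'=\mathrm{l.c.m.}\{n'_i,m'_j\mid i=1,\dots,h,\ j=1,\dots,t\}$ are equal.
   Context: An MV-algebra is a structure $(A,\oplus,\neg,0)$ such that $(A,\oplus,0)$ is a commutative monoid, $\neg\neg x=x$, $x\oplus\neg 0=\neg 0$ and $\neg(\neg x\oplus y)\oplus y=\neg(\neg y\oplus x)\oplus x$. For a lattice-ordered abelian group $G$ and $u\ge 0$ in $G$, $\Gamma(G,u)$ is the MV-algebra on $[0,u]$ with $x\oplus y=\inf(x+y,u)$, $\neg x=u-x$. For a positive integer $m$, $S_m=\Gamma(\mathbb{Z},m)$ and $S_m^\omega=\Gamma(\mathbb{Z}\times_{\mathrm{lex}}\mathbb{Z},(m,0))$, where $\mathbb{Z}\times_{\mathrm{lex}}\mathbb{Z}$ is the lexicographic product. $V(\dots)$ denotes the variety of MV-algebras generated by the listed algebras; a Komori variety is a variety generated in this way by finitely many (at least one) algebras of the forms $S_m$ and $S_m^\omega$. *)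

theory Defs
  imports Main "HOL-Library.Lattice_Algebras" "HOL-Library.Product_Lexorder"
    "HOL-Library.Product_Plus"
begin

section \<open>MV-algebras\<close>

record 'a mv =
  mv_carrier :: "'a set"
  mv_plus :: "'a \<Rightarrow> 'a \<Rightarrow> 'a"
  mv_neg :: "'a \<Rightarrow> 'a"
  mv_zero :: "'a"

locale mv_algebra =
  fixes A :: "'a mv" (structure)
  assumes zero_closed: "mv_zero A \<in> mv_carrier A"
    and neg_closed: "x \<in> mv_carrier A \<Longrightarrow> mv_neg A x \<in> mv_carrier A"
    and plus_closed: "x \<in> mv_carrier A \<Longrightarrow> y \<in> mv_carrier A \<Longrightarrow> mv_plus A x y \<in> mv_carrier A"
    and plus_assoc: "x \<in> mv_carrier A \<Longrightarrow> y \<in> mv_carrier A \<Longrightarrow> z \<in> mv_carrier A \<Longrightarrow>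
      mv_plus A (mv_plus A x y) z = mv_plus A x (mv_plus A y z)"
    and plus_comm: "x \<in> mv_carrier A \<Longrightarrow> y \<in> mv_carrier A \<Longrightarrow> mv_plus A x y = mv_plus A y x"
    and plus_zero: "x \<in> mv_carrier A \<Longrightarrow> mv_plus A x (mv_zero A) = x"
    and neg_neg: "x \<in> mv_carrier A \<Longrightarrow> mv_neg A (mv_neg A x) = x"
    and plus_neg_zero: "x \<in> mv_carrier A \<Longrightarrow>
      mv_plus A x (mv_neg A (mv_zero A)) = mv_neg A (mv_zero A)"
    and mv_exchange: "x \<in> mv_carrier A \<Longrightarrow> y \<in> mv_carrier A \<Longrightarrow>
      mv_plus A (mv_neg A (mv_plus A (mv_neg A x) y)) y =
      mv_plus A (mv_neg A (mv_plus A (mv_neg A y) x)) x"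


section \<open>The algebras \<open>\<Gamma>(G, u)\<close>, \<open>S\<^sub>m\<close> and \<open>S\<^sub>m\<^sup>\<omega>\<close>\<close>

definition mv_Gamma :: "'g::lattice_ab_group_add \<Rightarrow> 'g mv" where
  "mv_Gamma u = \<lparr> mv_carrier = {0..u}, mv_plus = (\<lambda>x y. inf (x + y) u),
                 mv_neg = (\<lambda>x. u - x), mv_zero = 0 \<rparr>"

lemma mv_algebra_mv_Gamma:
  fixes u :: "'g::lattice_ab_group_add"
  assumes u: "0 \<le> u"
  shows "mv_algebra (mv_Gamma u)"
proof -
  have join: "inf (u - inf (u - x + y) u + y) u = inf (sup x y) u" for x y :: 'g
  proof -
    have "u - inf (u - x + y) u = sup (x - y) 0"
      by (simp add: diff_inf_eq_sup add_sup_distrib_left)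
    then show ?thesis by (simp add: add_sup_distrib_right)
  qed
  have absorb: "inf (inf a u + z) u = inf (a + z) u" if "0 \<le> z" for a z :: 'g
  proof -
    have "inf (inf a u + z) u = inf (a + z) (inf (u + z) u)"
      by (simp add: add_inf_distrib_right inf_assoc)
    also have "inf (u + z) u = u"
      using that by (simp add: inf_absorb2)
    finally show ?thesis .
  qed
  show ?thesis
  proof
    fix x y z
    assume xyz: "x \<in> mv_carrier (mv_Gamma u)" "y \<in> mv_carrier (mv_Gamma u)"
      "z \<in> mv_carrier (mv_Gamma u)"
    have "inf (inf (x + y) u + z) u = inf (x + y + z) u"
      using xyz by (intro absorb) (simp add: mv_Gamma_def)
    also have "\<dots> = inf (inf (y + z) u + x) u"
      using xyz by (subst absorb) (simp_all add: mv_Gamma_def add_ac)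
    finally show "mv_plus (mv_Gamma u) (mv_plus (mv_Gamma u) x y) z =
        mv_plus (mv_Gamma u) x (mv_plus (mv_Gamma u) y z)"
      by (simp add: mv_Gamma_def add.commute)
  next
    fix x y
    show "mv_plus (mv_Gamma u) (mv_neg (mv_Gamma u) (mv_plus (mv_Gamma u) (mv_neg (mv_Gamma u) x) y)) y =
      mv_plus (mv_Gamma u) (mv_neg (mv_Gamma u) (mv_plus (mv_Gamma u) (mv_neg (mv_Gamma u) y) x)) x"
      by (simp add: mv_Gamma_def join sup_commute del: diff_inf_eq_sup)
  qed (use u in \<open>auto simp: mv_Gamma_def add.commute inf_absorb1 inf_absorb2\<close>)
qed

definition mv_S :: "nat \<Rightarrow> int mv" where
  "mv_S m = mv_Gamma (int m)"

text \<open>\<open>\<int> \<times>\<^sub>l\<^sub>e\<^sub>x \<int>\<close> is the type \<^typ>\<open>int \<times> int\<close> with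
  componentwise addition (\<^theory>\<open>HOL-Library.Product_Plus\<close>) and the lexicographic order of
  \<^theory>\<open>HOL-Library.Product_Lexorder\<close>.\<close>

instance prod :: (linordered_ab_group_add, linordered_ab_group_add) linordered_ab_group_add
  by standard (auto simp: less_eq_prod_def)

instance prod :: (linordered_ab_group_add, linordered_ab_group_add) lattice_ab_group_add ..

definition mv_S_omega :: "nat \<Rightarrow> (int \<times> int) mv" where
  "mv_S_omega m = mv_Gamma (int m, 0)"


section \<open>Identities and varieties\<close>

datatype mv_term = Var nat | Zero | Neg mv_term | Plus mv_term mv_term

type_synonym mv_identity = "mv_term \<times> mv_term"

primrec mv_eval :: "'a mv \<Rightarrow> (nat \<Rightarrow> 'a) \<Rightarrow> mv_term \<Rightarrow> 'a" where
  "mv_eval A v (Var i) = v i"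
| "mv_eval A v Zero = mv_zero A"
| "mv_eval A v (Neg t) = mv_neg A (mv_eval A v t)"
| "mv_eval A v (Plus s t) = mv_plus A (mv_eval A v s) (mv_eval A v t)"

definition mv_identities :: "'a mv \<Rightarrow> mv_identity set" where
  "mv_identities A =
    {(s, t). \<forall>v. range v \<subseteq> mv_carrier A \<longrightarrow> mv_eval A v s = mv_eval A v t}"

text \<open>A variety of MV-algebras is an equational class.  Since HOL has no class of all algebras,
  classes are formed inside a type \<^typ>\<open>'u\<close> containing the carriers; they are meant to be
  used for infinite \<^typ>\<open>'u\<close>, into which every countable algebra can be copied.\<close>

definition mv_models :: "mv_identity set \<Rightarrow> 'u mv set" where
  "mv_models E = {A. mv_algebra A \<and> E \<subseteq> mv_identities A}"

definition mv_variety :: "'u mv set \<Rightarrow> bool" where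
  "mv_variety V \<longleftrightarrow> (\<exists>E. V = mv_models E)"

text \<open>The variety \<open>V(S\<^sub>n\<^sub>1, \<dots>, S\<^sub>m\<^sub>1\<^sup>\<omega>, \<dots>)\<close> consists of the
  MV-algebras satisfying every identity that holds in all the generators.  This formulation is
  independent of the types on which the generators live; by the lemmas below it is the least
  variety containing (the copies of) the generators.\<close>

definition mv_gen_variety :: "nat list \<Rightarrow> nat list \<Rightarrow> 'u mv set" where
  "mv_gen_variety ns ms =
    mv_models ((\<Inter>n\<in>set ns. mv_identities (mv_S n)) \<inter>
               (\<Inter>m\<in>set ms. mv_identities (mv_S_omega m)))"

definition komori_variety :: "'u mv set \<Rightarrow> bool" where
  "komori_variety V \<longleftrightarrow>
    (\<exists>ns ms. ns @ ms \<noteq> [] \<and> (\<forall>n\<in>set (ns @ ms). 0 < n) \<and> V = mv_gen_variety ns ms)"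

definition mv_iso :: "'a mv \<Rightarrow> 'b mv \<Rightarrow> ('a \<Rightarrow> 'b) \<Rightarrow> bool" where
  "mv_iso A B f \<longleftrightarrow> bij_betw f (mv_carrier A) (mv_carrier B) \<and> f (mv_zero A) = mv_zero B \<and>
    (\<forall>x\<in>mv_carrier A. f (mv_neg A x) = mv_neg B (f x)) \<and>
    (\<forall>x\<in>mv_carrier A. \<forall>y\<in>mv_carrier A. f (mv_plus A x y) = mv_plus B (f x) (f y))"

lemma mv_eval_closed:
  assumes "mv_algebra A" "range v \<subseteq> mv_carrier A"
  shows "mv_eval A v t \<in> mv_carrier A"
  using assms by (induction t) (auto simp: mv_algebra_def)

lemma mv_identities_iso:
  fixes A :: "'a mv" and B :: "'b mv"
  assumes A: "mv_algebra A" and f: "mv_iso A B f"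
  shows "mv_identities A = mv_identities B"
proof -
  have eval: "mv_eval B (f \<circ> v) t = f (mv_eval A v t)" if "range v \<subseteq> mv_carrier A" for v t
    using f that mv_eval_closed[OF A that] by (induction t) (auto simp: mv_iso_def)
  have eq_iff: "mv_eval B (f \<circ> v) s = mv_eval B (f \<circ> v) t \<longleftrightarrow> mv_eval A v s = mv_eval A v t"
    if "range v \<subseteq> mv_carrier A" for v s t
    using f mv_eval_closed[OF A that] unfolding eval[OF that]
    by (auto simp: mv_iso_def bij_betw_def dest: inj_onD)
  have lift: "\<exists>v. range v \<subseteq> mv_carrier A \<and> w = f \<circ> v" if "range w \<subseteq> mv_carrier B" for w :: "nat \<Rightarrow> 'b"
  proof -
    have im: "mv_carrier B = f ` mv_carrier A"
      using f by (auto simp: mv_iso_def bij_betw_def)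
    have "\<forall>i. \<exists>x. x \<in> mv_carrier A \<and> w i = f x" using that im by blast
    then obtain v where "\<forall>i. v i \<in> mv_carrier A \<and> w i = f (v i)" by metis
    then show ?thesis by (intro exI[of _ v]) auto
  qed
  have push: "range (f \<circ> v) \<subseteq> mv_carrier B" if "range v \<subseteq> mv_carrier A"
    for v :: "nat \<Rightarrow> 'a"
    using f that by (auto simp: mv_iso_def bij_betw_def)
  have "(s, t) \<in> mv_identities A \<longleftrightarrow> (s, t) \<in> mv_identities B" for s t
  proof
    assume "(s, t) \<in> mv_identities A"
    then show "(s, t) \<in> mv_identities B"
      unfolding mv_identities_def by (auto dest!: lift simp: eq_iff)
  next
    assume "(s, t) \<in> mv_identities B"
    then have "mv_eval B (f \<circ> v) s = mv_eval B (f \<circ> v) t" if "range v \<subseteq> mv_carrier A" for v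
      using push[OF that] by (simp add: mv_identities_def)
    then show "(s, t) \<in> mv_identities A"
      by (simp add: mv_identities_def eq_iff)
  qed
  then show ?thesis by auto
qed

lemma mv_gen_variety_contains_S:
  assumes "n \<in> set ns" "mv_algebra A" "mv_iso A (mv_S n) f"
  shows "A \<in> mv_gen_variety ns ms"
  using assms mv_identities_iso[OF assms(2,3)] by (auto simp: mv_gen_variety_def mv_models_def)

lemma mv_gen_variety_contains_S_omega:
  assumes "m \<in> set ms" "mv_algebra A" "mv_iso A (mv_S_omega m) f"
  shows "A \<in> mv_gen_variety ns ms"
  using assms mv_identities_iso[OF assms(2,3)] by (auto simp: mv_gen_variety_def mv_models_def)

lemma mv_gen_variety_least:
  assumes V: "mv_variety V"
    and S: "\<And>n. n \<in> set ns \<Longrightarrow> \<exists>A\<in>V. \<exists>f. mv_iso A (mv_S n) f"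
    and S_omega: "\<And>m. m \<in> set ms \<Longrightarrow> \<exists>A\<in>V. \<exists>f. mv_iso A (mv_S_omega m) f"
  shows "mv_gen_variety ns ms \<subseteq> V"
proof -
  obtain E where E: "V = mv_models E" using V by (auto simp: mv_variety_def)
  have "E \<subseteq> mv_identities (mv_S n)" if "n \<in> set ns" for n
    using S[OF that] mv_identities_iso unfolding E mv_models_def by blast
  moreover have "E \<subseteq> mv_identities (mv_S_omega m)" if "m \<in> set ms" for m
    using S_omega[OF that] mv_identities_iso unfolding E mv_models_def by blast
  ultimately show ?thesis unfolding E mv_gen_variety_def mv_models_def by blast
qed

lemma mv_variety_mv_gen_variety: "mv_variety (mv_gen_variety ns ms)"
  by (auto simp: mv_variety_def mv_gen_variety_def)

end

theory Submission
  imports Defs "HOL-Library.Countable"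
begin

text \<open>
  The variety determines its least common multiple because, for each \<open>n > 0\<close>, one identity
  detects whether \<open>n\<close> divides the index of a generator.  Truncated linear functions
  \<open>x \<mapsto> 0 \<squnion> ((a x - b u) \<sqinter> u)\<close> are given by MV-terms.  Fix \<open>l\<close>, and consider the
  identity stating that these functions agree for the coefficients \<open>(l n, l - 1)\<close> and \<open>(l n, l)\<close>.
  It fails at \<open>x\<close> exactly when \<open>l n x\<close> lies strictly between \<open>(l - 1) u\<close> and \<open>(l + 1) u\<close>,
  that is, when \<open>x\<close> lies in a small neighbourhood of \<open>u / n\<close>.
  It therefore fails in \<open>S\<^sub>n\<close> and in \<open>S\<^sub>n\<^sup>\<omega>\<close>, where \<open>u / n\<close> is an element.  If \<open>n\<close> does not
  divide \<open>m\<close> and \<open>m < l\<close>, it holds in \<open>S\<^sub>m\<close> and also in \<open>S\<^sub>m\<^sup>\<omega>\<close>: every integer \<open>k\<close>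
  satisfies \<open>\<bar>l n k - l m\<bar> \<ge> l > m\<close>, and an infinitesimal summand cannot affect a strict
  inequality between first components.

  Choose \<open>l\<close> above all indices of one list of generators.  If no index in that list is a
  multiple of \<open>n\<close>, then the identity holds in the generated variety, and so neither \<open>S\<^sub>n\<close> nor
  \<open>S\<^sub>n\<^sup>\<omega>\<close> belongs to it (\<open>gen_variety_index_dvd\<close>).  Hence every index in either list
  divides some index in the other one, and the two least common multiples divide each other.
\<close>

section \<open>Truncated linear functions as MV-terms\<close>

definition clamp :: "'g::lattice_ab_group_add \<Rightarrow> 'g \<Rightarrow> 'g" where
  "clamp u z = sup 0 (inf z u)"

lemma clamp_nonpos: "z \<le> 0 \<Longrightarrow> 0 \<le> u \<Longrightarrow> clamp u z = 0"
  by (simp add: clamp_def inf_absorb1 sup_absorb1)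

lemma clamp_above: "u \<le> z \<Longrightarrow> 0 \<le> u \<Longrightarrow> clamp u z = u"
  by (simp add: clamp_def inf_absorb2 sup_absorb2)

lemma clamp_nonneg: "0 \<le> z \<Longrightarrow> 0 \<le> u \<Longrightarrow> clamp u z = inf z u"
  by (simp add: clamp_def sup_absorb2)

lemma clamp_le: "z \<le> u \<Longrightarrow> clamp u z = sup 0 z"
  by (simp add: clamp_def inf_absorb1)

lemma inf_plus_truncated:
  fixes z x u :: "'g::lattice_ab_group_add"
  assumes "0 \<le> x"
  shows "inf (inf z u + x) u = inf (z + x) u"
proof -
  have "inf (inf z u + x) u = inf (z + x) (inf (u + x) u)"
    by (simp add: add_inf_distrib_right inf_assoc)
  also have "inf (u + x) u = u"
    using assms by (simp add: inf_absorb2)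
  finally show ?thesis .
qed

text \<open>
  This is the step that raises the slope of a truncated linear function by one.  One of the two
  truncations on the right is constant: the one of \<open>z + u\<close> equals \<open>u\<close> if \<open>z \<ge> 0\<close>, and the one
  of \<open>z\<close> vanishes if \<open>z \<le> 0\<close>.
\<close>

lemma clamp_plus:
  fixes u x z :: "'g::{linordered_ab_group_add,lattice_ab_group_add}"
  assumes x: "0 \<le> x" "x \<le> u"
  shows "clamp u (z + x) =
    u - inf (u - inf (clamp u z + x) u + (u - clamp u (z + u))) u"
proof (cases "0 \<le> z")
  case True
  have u: "0 \<le> u" using x by (rule order_trans)
  have z: "clamp u z = inf z u" "clamp u (z + u) = u" "clamp u (z + x) = inf (z + x) u"
    using True u x by (simp_all add: clamp_nonneg inf_absorb2)
  have "0 \<le> inf (z + x) u" using True x u by simp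
  then have "inf (u - inf (z + x) u) u = u - inf (z + x) u"
    by (intro inf_absorb1) (simp only: diff_le_eq le_add_same_cancel1)
  then show ?thesis
    using x by (simp add: z inf_plus_truncated add.commute[of x z] del: diff_inf_eq_sup)
next
  case False
  then have z0: "z \<le> 0" by simp
  have u: "0 \<le> u" using x by (rule order_trans)
  have "z + x \<le> u" using add_mono[OF z0 x(2)] by simp
  then have z: "clamp u z = 0" "clamp u (z + u) = sup 0 (z + u)" "clamp u (z + x) = sup 0 (z + x)"
    using z0 u by (simp_all add: clamp_nonpos clamp_le)
  show ?thesis
  proof (cases "0 \<le> z + u")
    case True
    have "u - inf (u - x + (u - (z + u))) u = sup 0 (z + x)"
      by (simp add: diff_inf_eq_sup add_sup_distrib_left sup_commute algebra_simps)
    moreover have "inf (0 + x) u = x" "sup 0 (z + u) = z + u"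
      using True x by (simp_all add: inf_absorb1 sup_absorb2)
    ultimately show ?thesis by (simp only: z)
  next
    case False
    then have zu: "z + u \<le> 0" by simp
    then have "z + x \<le> 0" using add_left_mono[OF x(2), of z] by (rule order_trans[rotated])
    moreover have "inf (u - x + u) u = u"
      using x by (intro inf_absorb2) simp
    ultimately show ?thesis
      using zu x by (simp add: z sup_absorb1 inf_absorb1 del: diff_inf_eq_sup)
  qed
qed

text \<open>
  The term for \<open>x \<mapsto> clamp u (a x - b u)\<close>.  Each unit of slope is gained through \<open>clamp_plus\<close>; the
  outer negations in the last equation form the product dual to \<open>\<oplus>\<close>.
\<close>

fun clamp_term :: "nat \<Rightarrow> nat \<Rightarrow> mv_term" where
  "clamp_term 0 b = Zero"
| "clamp_term (Suc a) 0 = Plus (clamp_term a 0) (Var 0)"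
| "clamp_term (Suc a) (Suc b) =
    Neg (Plus (Neg (Plus (clamp_term a (Suc b)) (Var 0))) (Neg (clamp_term a b)))"

lemma eval_clamp_term:
  fixes u :: "'g::{linordered_ab_group_add,lattice_ab_group_add}"
  assumes x: "0 \<le> v 0" "v 0 \<le> u"
  shows "mv_eval (mv_Gamma u) v (clamp_term a b) = clamp u ((\<Sum>i<a. v 0) - (\<Sum>i<b. u))"
proof (induction a b rule: clamp_term.induct)
  case (1 b)
  have "0 \<le> u" using x by (rule order_trans)
  then have "clamp u (- (\<Sum>i<b. u)) = 0" by (intro clamp_nonpos) (simp_all add: sum_nonneg)
  then show ?case by (simp add: mv_Gamma_def)
next
  case (2 a)
  have u: "0 \<le> u" using x by (rule order_trans)
  have "0 \<le> (\<Sum>i<a. v 0)" using x by (simp add: sum_nonneg)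
  then show ?case
    using 2 x u by (simp add: mv_Gamma_def clamp_nonneg inf_plus_truncated)
next
  case (3 a b)
  show ?case
    using clamp_plus[OF x, of "(\<Sum>i<a. v 0) - (\<Sum>i<Suc b. u)"] 3
    by (simp add: mv_Gamma_def algebra_simps del: diff_inf_eq_sup)
qed

section \<open>An identity detecting divisibility of the index\<close>

text \<open>With \<open>l = Suc c\<close>, this asserts that no element lies near \<open>u / n\<close>.\<close>

definition gap_identity :: "nat \<Rightarrow> nat \<Rightarrow> mv_identity" where
  "gap_identity n c = (clamp_term (Suc c * n) c, clamp_term (Suc c * n) (Suc c))"

lemma gap_identity_holds:
  fixes u :: "'g::{linordered_ab_group_add,lattice_ab_group_add}"
  assumes "0 \<le> u"
    and gap: "\<And>x. 0 \<le> x \<Longrightarrow> x \<le> u \<Longrightarrow>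
      (\<Sum>i<Suc c * n. x) \<le> (\<Sum>i<c. u) \<or> (\<Sum>i<Suc (Suc c). u) \<le> (\<Sum>i<Suc c * n. x)"
  shows "gap_identity n c \<in> mv_identities (mv_Gamma u)"
proof -
  have "mv_eval (mv_Gamma u) v (clamp_term (Suc c * n) c) =
      mv_eval (mv_Gamma u) v (clamp_term (Suc c * n) (Suc c))"
    if "range v \<subseteq> mv_carrier (mv_Gamma u)" for v
  proof -
    have x: "0 \<le> v 0" "v 0 \<le> u" using range_subsetD[OF that, of 0] by (simp_all add: mv_Gamma_def)
    let ?s = "\<Sum>i<Suc c * n. v 0"
    from gap[OF x] have "clamp u (?s - (\<Sum>i<c. u)) = clamp u (?s - (\<Sum>i<Suc c. u))"
    proof
      assume le: "?s \<le> (\<Sum>i<c. u)"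
      also have "\<dots> \<le> (\<Sum>i<Suc c. u)" using assms(1) by simp
      finally show ?thesis using le assms(1) by (simp add: clamp_nonpos del: sum.lessThan_Suc)
    next
      assume le: "(\<Sum>i<Suc (Suc c). u) \<le> ?s"
      then have "u \<le> ?s - (\<Sum>i<Suc c. u)" by (simp add: algebra_simps)
      moreover from this have "u \<le> ?s - (\<Sum>i<c. u)"
        by (rule order_trans) (use assms(1) in simp)
      ultimately show ?thesis using assms(1) by (simp only: clamp_above)
    qed
    then show ?thesis by (simp only: eval_clamp_term[of v, OF x])
  qed
  then show ?thesis by (simp add: gap_identity_def mv_identities_def)
qed

text \<open>An element \<open>x\<close> with \<open>n x = u\<close> is a witness: the two sides take the values \<open>u\<close> and \<open>0\<close> at it.\<close>

lemma gap_identity_fails: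
  fixes u x :: "'g::{linordered_ab_group_add,lattice_ab_group_add}"
  assumes u: "0 < u" and x: "0 \<le> x" "x \<le> u" and nx: "(\<Sum>i<n. x) = u"
  shows "gap_identity n c \<notin> mv_identities (mv_Gamma u)"
proof
  assume "gap_identity n c \<in> mv_identities (mv_Gamma u)"
  then have "mv_eval (mv_Gamma u) (\<lambda>_. x) (clamp_term (Suc c * n) c) =
      mv_eval (mv_Gamma u) (\<lambda>_. x) (clamp_term (Suc c * n) (Suc c))"
    using x by (auto simp: gap_identity_def mv_identities_def mv_Gamma_def)
  moreover have "(\<Sum>i<l * n. x) = (\<Sum>i<l. u)" for l
  proof (induction l)
    case (Suc l)
    have "(\<Sum>i<a + b. x) = (\<Sum>i<a. x) + (\<Sum>i<b. x)" for a b :: nat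
      by (induction b) (simp_all add: add.assoc)
    from this[of n "l * n"] show ?case using Suc nx by (simp add: add.commute)
  qed simp
  ultimately have "clamp u ((\<Sum>i<Suc c. u) - (\<Sum>i<c. u)) = clamp u ((\<Sum>i<Suc c. u) - (\<Sum>i<Suc c. u))"
    using x by (simp only: eval_clamp_term)
  then have "clamp u u = clamp u 0" by simp
  then show False using u by (simp add: clamp_above clamp_nonpos)
qed

lemma sum_const_int_pair: "(\<Sum>i<a. (k, e)) = (int a * k, int a * e)"
  by (induction a) (simp_all add: zero_prod_def algebra_simps)

text \<open>
  Multiples of \<open>l\<close> within distance \<open>m < l\<close> of one another coincide, so in this range only
  \<open>n k = m\<close> could spoil the gap.  Strictness is what makes the estimate usable for the
  lexicographic order.
\<close>

lemma index_gap:
  fixes k :: int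
  assumes "\<not> n dvd m" "m \<le> c"
  shows "int (Suc c * n) * k < int c * int m \<or> int (Suc (Suc c)) * int m < int (Suc c * n) * k"
proof -
  have "int n * k \<noteq> int m"
    using assms(1) by (metis dvd_triv_left int_dvd_int_iff)
  then consider "int n * k + 1 \<le> int m" | "int m + 1 \<le> int n * k" by linarith
  then show ?thesis
  proof cases
    case 1
    from mult_left_mono[OF this, of "int (Suc c)"] show ?thesis
      using assms(2) by (simp add: algebra_simps)
  next
    case 2
    from mult_left_mono[OF this, of "int (Suc c)"] show ?thesis
      using assms(2) by (simp add: algebra_simps)
  qed
qed

lemma gap_identity_S:
  assumes "\<not> n dvd m" "m \<le> c"
  shows "gap_identity n c \<in> mv_identities (mv_S m)"
  unfolding mv_S_def
proof (rule gap_identity_holds)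
  fix k :: int
  show "(\<Sum>i<Suc c * n. k) \<le> (\<Sum>i<c. int m) \<or> (\<Sum>i<Suc (Suc c). int m) \<le> (\<Sum>i<Suc c * n. k)"
    using index_gap[OF assms, of k] by (simp only: sum_constant card_lessThan) auto
qed simp

lemma gap_identity_S_omega:
  assumes "\<not> n dvd m" "m \<le> c"
  shows "gap_identity n c \<in> mv_identities (mv_S_omega m)"
  unfolding mv_S_omega_def
proof (rule gap_identity_holds)
  fix x :: "int \<times> int"
  obtain k e where "x = (k, e)" by force
  then show "(\<Sum>i<Suc c * n. x) \<le> (\<Sum>i<c. (int m, 0)) \<or>
      (\<Sum>i<Suc (Suc c). (int m, 0)) \<le> (\<Sum>i<Suc c * n. x)"
    using index_gap[OF assms, of k] by (simp only: sum_const_int_pair) (auto simp: less_eq_prod_def)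
qed (simp add: zero_prod_def less_eq_prod_def)

lemma not_gap_identity_S:
  assumes "0 < n"
  shows "gap_identity n c \<notin> mv_identities (mv_S n)"
  unfolding mv_S_def using assms by (intro gap_identity_fails[where x = 1]) auto

lemma not_gap_identity_S_omega:
  assumes "0 < n"
  shows "gap_identity n c \<notin> mv_identities (mv_S_omega n)"
  unfolding mv_S_omega_def using assms
  by (intro gap_identity_fails[where x = "(1, 0)"])
    (auto simp: sum_const_int_pair zero_prod_def less_prod_def less_eq_prod_def)

section \<open>Copies of countable algebras and the comparison of generators\<close>

lemma countable_mv_algebra_copy:
  fixes A :: "'a::countable mv"
  assumes inf: "infinite (UNIV :: 'u set)" and A: "mv_algebra A"
  obtains B :: "'u mv" and g where "mv_algebra B" "mv_iso B A g"
proof -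
  obtain h :: "nat \<Rightarrow> 'u" where "inj h"
    using infinite_countable_subset[OF inf] by blast
  then have "inj (h \<circ> (to_nat :: 'a \<Rightarrow> nat))" by (simp add: inj_compose)
  then obtain f :: "'a \<Rightarrow> 'u" where f: "inj f" by blast
  define B where "B = \<lparr> mv_carrier = f ` mv_carrier A,
    mv_plus = (\<lambda>x y. f (mv_plus A (inv f x) (inv f y))),
    mv_neg = (\<lambda>x. f (mv_neg A (inv f x))), mv_zero = f (mv_zero A) \<rparr>"
  interpret A: mv_algebra A by (rule A)
  have comm: "f (mv_plus A x y) = f (mv_plus A y x)"
    if "x \<in> mv_carrier A" "y \<in> mv_carrier A" for x y
    using A.plus_comm[OF that] by simp
  have exchange: "f (mv_plus A (mv_neg A (mv_plus A (mv_neg A x) y)) y) =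
      f (mv_plus A (mv_neg A (mv_plus A (mv_neg A y) x)) x)"
    if "x \<in> mv_carrier A" "y \<in> mv_carrier A" for x y
    using A.mv_exchange[OF that] by simp
  have "mv_algebra B"
    by standard
      (use f in \<open>auto simp: B_def A.zero_closed A.neg_closed A.plus_closed A.plus_assoc A.plus_zero
        A.neg_neg A.plus_neg_zero intro: comm exchange\<close>)
  moreover have "mv_iso B A (inv f)"
    using f by (auto simp: mv_iso_def B_def bij_betw_def inj_on_def image_image)
  ultimately show thesis by (rule that)
qed

text \<open>
  Here \<open>A\<close> lives on a type of its own, so its membership in a class of models over \<open>'u\<close> is
  expressed through its isomorphic copies.
\<close>

lemma models_identities_of_copies:
  fixes A :: "'a::countable mv"
  assumes inf: "infinite (UNIV :: 'u set)" and A: "mv_algebra A"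
    and mem: "\<And>(B :: 'u mv) g. mv_algebra B \<Longrightarrow> mv_iso B A g \<Longrightarrow> B \<in> mv_models E"
  shows "E \<subseteq> mv_identities A"
proof -
  obtain B :: "'u mv" and g where B: "mv_algebra B" "mv_iso B A g"
    using countable_mv_algebra_copy[OF inf A] .
  then show ?thesis using mem[OF B] mv_identities_iso[OF B] by (simp add: mv_models_def)
qed

text \<open>
  The gap identity for \<open>p\<close> fails in the generator with index \<open>p\<close>.  Hence it cannot hold in all of
  the other generators, which forces one of their indices to be a multiple of \<open>p\<close>.
\<close>

lemma gen_variety_index_dvd:
  assumes inf: "infinite (UNIV :: 'u set)"
    and sub: "(mv_gen_variety ns ms :: 'u mv set) \<subseteq> mv_gen_variety ns' ms'"
    and p: "p \<in> set ns \<union> set ms" "0 < p"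
  shows "\<exists>q \<in> set ns' \<union> set ms'. p dvd q"
proof (rule ccontr)
  assume "\<not> ?thesis"
  then have ndvd: "\<not> p dvd q" if "q \<in> set ns' \<union> set ms'" for q using that by blast
  define c where "c = Max (insert 0 (set ns' \<union> set ms'))"
  have c: "q \<le> c" if "q \<in> set ns' \<union> set ms'" for q
    using that unfolding c_def by (intro Max_ge) auto
  define E where "E = (\<Inter>n\<in>set ns'. mv_identities (mv_S n)) \<inter>
    (\<Inter>m\<in>set ms'. mv_identities (mv_S_omega m))"
  have gen: "(mv_gen_variety ns' ms' :: 'u mv set) = mv_models E"
    by (simp add: mv_gen_variety_def E_def)
  have gap: "gap_identity p c \<in> E"
    unfolding E_def using ndvd c by (auto intro: gap_identity_S gap_identity_S_omega)
  from p(1) show False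
  proof
    assume "p \<in> set ns"
    then have "E \<subseteq> mv_identities (mv_S p)"
      using mv_gen_variety_contains_S sub unfolding gen
      by (intro models_identities_of_copies[OF inf])
        (fastforce simp: mv_S_def intro: mv_algebra_mv_Gamma)+
    then show False using gap not_gap_identity_S[OF p(2)] by blast
  next
    assume "p \<in> set ms"
    moreover have "mv_algebra (mv_S_omega p)"
      unfolding mv_S_omega_def by (rule mv_algebra_mv_Gamma) (simp add: zero_prod_def less_eq_prod_def)
    ultimately have "E \<subseteq> mv_identities (mv_S_omega p)"
      using mv_gen_variety_contains_S_omega sub unfolding gen
      by (intro models_identities_of_copies[OF inf]) fastforce+
    then show False using gap not_gap_identity_S_omega[OF p(2)] by blast
  qed
qed

theorem proposition5p1:
  fixes V :: "'u mv set" and ns ms ns' ms' :: "nat list"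
  assumes "infinite (UNIV :: 'u set)"
    and "komori_variety V"
    and "ns @ ms \<noteq> []" and "\<forall>n\<in>set (ns @ ms). 0 < n"
    and "ns' @ ms' \<noteq> []" and "\<forall>n\<in>set (ns' @ ms'). 0 < n"
    and "V = mv_gen_variety ns ms"
    and "V = mv_gen_variety ns' ms'"
  shows "Lcm (set ns \<union> set ms) = Lcm (set ns' \<union> set ms')"
proof -
  have eq: "(mv_gen_variety ns ms :: 'u mv set) = mv_gen_variety ns' ms'"
    using assms(7,8) by simp
  show ?thesis
  proof (rule dvd_antisym)
    show "Lcm (set ns \<union> set ms) dvd Lcm (set ns' \<union> set ms')"
    proof (rule Lcm_least)
      fix p assume "p \<in> set ns \<union> set ms"
      then obtain q where "q \<in> set ns' \<union> set ms'" "p dvd q"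
        using gen_variety_index_dvd[OF assms(1) equalityD1[OF eq]] assms(4) by auto
      then show "p dvd Lcm (set ns' \<union> set ms')" by (meson dvd_Lcm dvd_trans)
    qed
    show "Lcm (set ns' \<union> set ms') dvd Lcm (set ns \<union> set ms)"
    proof (rule Lcm_least)
      fix p assume "p \<in> set ns' \<union> set ms'"
      then obtain q where "q \<in> set ns \<union> set ms" "p dvd q"
        using gen_variety_index_dvd[OF assms(1) equalityD2[OF eq]] assms(6) by auto
      then show "p dvd Lcm (set ns \<union> set ms)" by (meson dvd_Lcm dvd_trans)
    qed
  qed
qed

end
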